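(* Let $f,g,I$ be as in the context, let $L=L_f\vee L_g$, $\mu=\mu_f\wedge\mu_g$, $L_H=(I_{xx}\vee I_{yy})+I_{xy}$, and let $K\ge 1$. Run the AG-OG algorithm (see context) with $\alpha_k=\frac{2}{k+2}$, $\eta_k=\frac{k+2}{2L+\sqrt{3+\sqrt3}\,L_H(k+2)}$ and initialization $z_{-1/2}=z_0^{\mathrm{ag}}=z_0\in\mathbb R^{n+m}$. Then its output $z_K^{\mathrm{ag}}$ satisfies $$\|z_K^{\mathrm{ag}}-z^*\|^2\le\left(\frac{4L}{\mu(K+1)^2}+\frac{2\sqrt{3+\sqrt3}\,L_H}{\mu(K+1)}\right)\|z_0-z^*\|^2 .$$
   Context: Setting. $a\vee b=\max(a,b)$, $a\wedge b=\min(a,b)$, $\|\cdot\|$ is the Euclidean norm. $f:\mathbb R^n\to\mathbb R$ is $\mu_f$-strongly convex and $L_f$-smooth, $g:\mathbb R^m\to\mathbb R$ is $\mu_g$-strongly convex and $L_g$-smooth ($\mu_f,\mu_g>0$; $L$-smooth means differentiable with $L$-Lipschitz gradient). $I:\mathbb R^n\times\mathbb R^m\to\mathbb R$ is smooth, convex in $x$ and concave in $y$, with blockwise smoothness parameters $I_{xx},I_{xy},I_{yy}$: in operator norm, $\|\nabla^2_{xx}I\|\le I_{xx}$, $\|\nabla^2_{xy}I\|\le I_{xy}$, $\|\nabla^2_{yy}I\|\le I_{yy}$ everywhere. The problem is $\min_{x}\max_{y} f(x)+I(x,y)-g(y)$. Write $z=[x;y]\in\mathbb R^{n+m}$, $F(z)=f(x)+g(y)$,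 $H(z)=[\nabla_xI(x,y);-\nabla_yI(x,y)]$. $z^*=[x^*;y^*]$ is the unique saddle point, i.e. the unique point with $\nabla F(z^* )+H(z^* )=0$. AG-OG algorithm with inputs $(z_0^{\mathrm{ag}},z_0,z_{-1/2},K)$: for $k=0,\dots,K-1$, $z_k^{\mathrm{md}}=(1-\alpha_k)z_k^{\mathrm{ag}}+\alpha_kz_k$; $z_{k+1/2}=z_k-\eta_k\big(H(z_{k-1/2})+\nabla F(z_k^{\mathrm{md}})\big)$; $z_{k+1}^{\mathrm{ag}}=(1-\alpha_k)z_k^{\mathrm{ag}}+\alpha_kz_{k+1/2}$; $z_{k+1}=z_k-\eta_k\big(H(z_{k+1/2})+\nabla F(z_k^{\mathrm{md}})\big)$. Output: $z_K^{\mathrm{ag}}$. *)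

theory Defs
  imports "HOL-Analysis.Analysis"
begin

text \<open>
  \<open>R\<^sup>n \<times> R\<^sup>m\<close> is the product type; its library norm is the Euclidean norm
  \<open>sqrt (norm x ^ 2 + norm y ^ 2)\<close> and its inner product the sum of the two inner products,
  so it is \<open>R\<^sup>n\<^sup>+\<^sup>m\<close> with the stacked vector \<open>z = [x; y]\<close> written \<open>(x, y)\<close>.
\<close>

text \<open>The description is only meaningful where the function is differentiable.\<close>

definition grad :: "('a::real_inner \<Rightarrow> real) \<Rightarrow> 'a \<Rightarrow> 'a" where
  "grad h x = (THE d. GDERIV h x :> d)"

definition strongly_convex :: "real \<Rightarrow> ('a::real_inner \<Rightarrow> real) \<Rightarrow> bool" where
  "strongly_convex \<mu> h \<longleftrightarrow>
    (\<forall>x y. \<forall>t\<in>{0..1}. h ((1 - t) *\<^sub>R x + t *\<^sub>R y)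
        \<le> (1 - t) * h x + t * h y - \<mu> / 2 * t * (1 - t) * (norm (x - y))\<^sup>2)"

definition L_smooth :: "real \<Rightarrow> ('a::real_inner \<Rightarrow> real) \<Rightarrow> bool" where
  "L_smooth L h \<longleftrightarrow> (\<forall>x. h differentiable (at x)) \<and> L-lipschitz_on UNIV (grad h)"

text \<open>Twice continuously differentiable; the second derivative at a point is the Hessian, as a
  bounded linear operator, and its continuity is with respect to the operator norm.\<close>

definition C2 :: "('a::real_inner \<Rightarrow> real) \<Rightarrow> bool" where
  "C2 h \<longleftrightarrow> (\<forall>z. h differentiable (at z)) \<and>
    (\<exists>D2 :: 'a \<Rightarrow> 'a \<Rightarrow>\<^sub>L 'a.
        (\<forall>z. (grad h has_derivative blinfun_apply (D2 z)) (at z)) \<and> continuous_on UNIV D2)"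

definition grad_x :: "('a::real_inner \<times> 'b::real_inner \<Rightarrow> real) \<Rightarrow> 'a \<Rightarrow> 'b \<Rightarrow> 'a" where
  "grad_x I x y = grad (\<lambda>x'. I (x', y)) x"

definition grad_y :: "('a::real_inner \<times> 'b::real_inner \<Rightarrow> real) \<Rightarrow> 'a \<Rightarrow> 'b \<Rightarrow> 'b" where
  "grad_y I x y = grad (\<lambda>y'. I (x, y')) y"

text \<open>Hessian blocks as linear maps, so that \<^const>\<open>onorm\<close> is their operator norm. The mixed block
  is the matrix with entries \<open>\<partial>\<^sup>2I / \<partial>x\<^sub>i \<partial>y\<^sub>j\<close>, acting from the y-space to the x-space.\<close>

definition hess_xx :: "('a::real_inner \<times> 'b::real_inner \<Rightarrow> real) \<Rightarrow> 'a \<Rightarrow> 'b \<Rightarrow> 'a \<Rightarrow> 'a" where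
  "hess_xx I x y = frechet_derivative (\<lambda>x'. grad_x I x' y) (at x)"

definition hess_xy :: "('a::real_inner \<times> 'b::real_inner \<Rightarrow> real) \<Rightarrow> 'a \<Rightarrow> 'b \<Rightarrow> 'b \<Rightarrow> 'a" where
  "hess_xy I x y = frechet_derivative (\<lambda>y'. grad_x I x y') (at y)"

definition hess_yy :: "('a::real_inner \<times> 'b::real_inner \<Rightarrow> real) \<Rightarrow> 'a \<Rightarrow> 'b \<Rightarrow> 'b \<Rightarrow> 'b" where
  "hess_yy I x y = frechet_derivative (\<lambda>y'. grad_y I x y') (at y)"

definition F_op :: "('a \<Rightarrow> real) \<Rightarrow> ('b \<Rightarrow> real) \<Rightarrow> 'a \<times> 'b \<Rightarrow> real" where
  "F_op f g z = f (fst z) + g (snd z)"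

definition H_op :: "('a::real_inner \<times> 'b::real_inner \<Rightarrow> real) \<Rightarrow> 'a \<times> 'b \<Rightarrow> 'a \<times> 'b" where
  "H_op I z = (grad_x I (fst z) (snd z), - grad_y I (fst z) (snd z))"

text \<open>The state before iteration \<open>k\<close> is the triple of \<open>z\<^sub>k\<close>-ag, \<open>z\<^sub>k\<close> and \<open>z\<close> at index \<open>k - 1/2\<close>;
  \<open>G\<close> plays the role of the gradient of \<open>F\<close>.\<close>

primrec agog_state ::
  "(nat \<Rightarrow> real) \<Rightarrow> (nat \<Rightarrow> real) \<Rightarrow> ('z \<Rightarrow> 'z) \<Rightarrow> ('z \<Rightarrow> 'z) \<Rightarrow> 'z \<Rightarrow> 'z \<Rightarrow> 'z
    \<Rightarrow> nat \<Rightarrow> 'z::real_vector \<times> 'z \<times> 'z" where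
  "agog_state \<alpha> \<eta> H G zag0 z0 zm 0 = (zag0, z0, zm)"
| "agog_state \<alpha> \<eta> H G zag0 z0 zm (Suc k) =
    (let (zag, z, zprev) = agog_state \<alpha> \<eta> H G zag0 z0 zm k;
         zmd = (1 - \<alpha> k) *\<^sub>R zag + \<alpha> k *\<^sub>R z;
         zhalf = z - \<eta> k *\<^sub>R (H zprev + G zmd)
     in ((1 - \<alpha> k) *\<^sub>R zag + \<alpha> k *\<^sub>R zhalf,
         z - \<eta> k *\<^sub>R (H zhalf + G zmd),
         zhalf))"

definition agog_output ::
  "(nat \<Rightarrow> real) \<Rightarrow> (nat \<Rightarrow> real) \<Rightarrow> ('z \<Rightarrow> 'z) \<Rightarrow> ('z \<Rightarrow> 'z) \<Rightarrow> 'z \<Rightarrow> 'z \<Rightarrow> 'z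
    \<Rightarrow> nat \<Rightarrow> 'z::real_vector" where
  "agog_output \<alpha> \<eta> H G zag0 z0 zm K = fst (agog_state \<alpha> \<eta> H G zag0 z0 zm K)"

end

theory Submission
  imports Defs
begin

text \<open>
  Let \<open>V\<close> be the Bregman divergence of \<open>F\<close> at the saddle point. Dividing the usual accelerated
  descent inequality by \<open>\<alpha>\<^sub>k / (2 \<eta>\<^sub>k)\<close> turns its distance terms into a telescoping sum with
  constant weights, and the weights of \<open>V\<close> telescope because \<open>k (k + 2) \<le> (k + 1)\<^sup>2\<close>. The
  extrapolation error is absorbed by adding the squared distance from \<open>z\<^sub>k\<close> to \<open>z\<close> at index
  \<open>k - 1/2\<close> to the potential; this needs only that the constant \<open>c\<close> in the step size is at
  least 2, and \<open>3 + sqrt 3 \<ge> 4\<close>. Finally \<open>V\<close> is at least \<open>\<mu> / 2\<close> times the squared distance.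
\<close>

section \<open>Gradients as vectors representing the derivative\<close>

lemma gderiv_unique:
  assumes "GDERIV h x :> a" and "GDERIV h x :> b"
  shows "a = b"
proof -
  have "(\<lambda>u. inner u a) = (\<lambda>u. inner u b)"
    using assms unfolding gderiv_def by (rule has_derivative_unique)
  from fun_cong[OF this, of "a - b"] have "inner (a - b) (a - b) = 0"
    by (simp add: inner_diff_right)
  then show ?thesis by simp
qed

lemma grad_eqI:
  assumes "GDERIV h x :> d"
  shows "grad h x = d"
  unfolding grad_def using assms by (rule the_equality) (rule gderiv_unique[OF _ assms])

text \<open>In finite dimension every linear functional is an inner product with a fixed vector.
  That vector is assembled here from the values of the derivative on \<open>Basis\<close>, so the
  description in \<open>grad\<close> denotes.\<close>

lemma gderiv_grad:
  fixes h :: "'a::euclidean_space \<Rightarrow> real"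
  assumes "h differentiable (at x)"
  shows "GDERIV h x :> grad h x"
proof -
  obtain h' where h': "(h has_derivative h') (at x)"
    using assms by (auto simp: differentiable_def)
  interpret bounded_linear h' using has_derivative_bounded_linear[OF h'] .
  define d where "d = (\<Sum>b\<in>Basis. h' b *\<^sub>R b)"
  have "h' = (\<lambda>u. inner u d)"
  proof
    fix u
    have "h' u = h' (\<Sum>b\<in>Basis. inner u b *\<^sub>R b)"
      by (simp add: euclidean_representation)
    also have "\<dots> = inner u d"
      by (simp add: sum scaleR d_def inner_sum_right mult.commute)
    finally show "h' u = inner u d" .
  qed
  then have d: "GDERIV h x :> d"
    using h' by (simp add: gderiv_def)
  show ?thesis
    unfolding grad_eqI[OF d] by (rule d)
qed

section \<open>Quadratic bounds from strong convexity and from a Lipschitz gradient\<close>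

lemma gderiv_line:
  assumes "GDERIV h (y + t *\<^sub>R v) :> d"
  shows "((\<lambda>s. h (y + s *\<^sub>R v)) has_real_derivative inner d v) (at t within S)"
proof -
  have 1: "((\<lambda>s. y + s *\<^sub>R v) has_derivative (\<lambda>s. s *\<^sub>R v)) (at t within S)"
    by (auto intro!: derivative_eq_intros)
  have "(h has_derivative (\<lambda>u. inner u d)) (at (y + t *\<^sub>R v))"
    using assms by (simp add: gderiv_def)
  from has_derivative_compose[OF 1 this] show ?thesis
    by (rule has_derivative_imp_has_field_derivative) (simp add: inner_commute)
qed

text \<open>Turn the convexity inequality at parameter \<open>s\<close> into a bound on a difference
  quotient and let \<open>s\<close> tend to 0 from the right. The factor \<open>1 - s\<close> tends
  to 1, so the full modulus \<open>\<mu> / 2\<close> survives.\<close>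

lemma strongly_convex_lower:
  assumes sc: "strongly_convex \<mu> h" and d: "GDERIV h y :> d"
  shows "h x \<ge> h y + inner d (x - y) + \<mu> / 2 * (norm (x - y))\<^sup>2"
proof -
  have "((\<lambda>s. h (y + s *\<^sub>R (x - y))) has_real_derivative inner d (x - y)) (at 0 within {0<..})"
    using d by (intro gderiv_line) auto
  then have lim: "((\<lambda>s. (h (y + s *\<^sub>R (x - y)) - h y) / s) \<longlongrightarrow> inner d (x - y)) (at_right 0)"
    by (simp add: has_field_derivative_iff)
  have lim2: "((\<lambda>s. h x - h y - \<mu> / 2 * (1 - s) * (norm (x - y))\<^sup>2)
      \<longlongrightarrow> h x - h y - \<mu> / 2 * (1 - 0) * (norm (x - y))\<^sup>2) (at_right 0)"
    by (intro tendsto_intros)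
  have "\<forall>\<^sub>F s in at_right 0. (h (y + s *\<^sub>R (x - y)) - h y) / s
      \<le> h x - h y - \<mu> / 2 * (1 - s) * (norm (x - y))\<^sup>2"
    using eventually_at_right_real[of 0 1, OF zero_less_one]
  proof eventually_elim
    case (elim s)
    have "h ((1 - s) *\<^sub>R y + s *\<^sub>R x)
        \<le> (1 - s) * h y + s * h x - \<mu> / 2 * s * (1 - s) * (norm (y - x))\<^sup>2"
      using sc elim unfolding strongly_convex_def by auto
    moreover have "(1 - s) *\<^sub>R y + s *\<^sub>R x = y + s *\<^sub>R (x - y)"
      by (simp add: algebra_simps)
    ultimately show ?case
      using elim by (simp add: field_simps norm_minus_commute)
  qed
  from tendsto_le[OF _ lim2 lim this] show ?thesis by simp
qed

lemma convex_lower: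
  assumes "convex_on UNIV h" and "GDERIV h y :> d"
  shows "h x \<ge> h y + inner d (x - y)"
proof -
  have "strongly_convex 0 h"
    using convex_onD[OF assms(1)] by (simp add: strongly_convex_def)
  from strongly_convex_lower[OF this assms(2), of x] show ?thesis by simp
qed

text \<open>Subtracting the linear and quadratic terms from \<open>h\<close> along the segment gives
  \<open>\<phi>\<close>, which is nonincreasing for nonnegative \<open>t\<close> by Cauchy-Schwarz
  and the Lipschitz bound.\<close>

lemma lipschitz_gradient_upper:
  assumes d: "\<And>z. GDERIV h z :> G z" and lip: "L-lipschitz_on UNIV G"
  shows "h x \<le> h y + inner (G y) (x - y) + L / 2 * (norm (x - y))\<^sup>2"
proof -
  define v where "v = x - y"
  define \<phi> where "\<phi> t = h (y + t *\<^sub>R v) - t * inner (G y) v - L / 2 * t\<^sup>2 * (norm v)\<^sup>2" for t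
  have "(\<phi> has_real_derivative (inner (G (y + t *\<^sub>R v) - G y) v - L * t * (norm v)\<^sup>2)) (at t)" for t
    unfolding \<phi>_def
    by (auto intro!: derivative_eq_intros gderiv_line[OF d] simp: inner_diff_left)
  moreover have "inner (G (y + t *\<^sub>R v) - G y) v - L * t * (norm v)\<^sup>2 \<le> 0" if "0 \<le> t" for t
  proof -
    have "inner (G (y + t *\<^sub>R v) - G y) v \<le> norm (G (y + t *\<^sub>R v) - G y) * norm v"
      by (rule norm_cauchy_schwarz)
    also have "\<dots> \<le> (L * norm (t *\<^sub>R v)) * norm v"
      using lipschitz_onD[OF lip, of "y + t *\<^sub>R v" y]
      by (intro mult_right_mono) (auto simp: dist_norm)
    finally show ?thesis using that by (simp add: power2_eq_square algebra_simps)
  qed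
  ultimately have "\<phi> 1 \<le> \<phi> 0"
    by (rule DERIV_nonpos_imp_nonincreasing[OF zero_le_one, OF exI, OF conjI])
  then show ?thesis by (simp add: \<phi>_def v_def)
qed

text \<open>The matrix with rows \<open>(a, b)\<close> and \<open>(b, a)\<close> is \<open>a\<close>
  times the identity plus \<open>b\<close> times the coordinate swap, which is an isometry. This
  explains the shape of \<open>LH\<close> as a sum of a diagonal and a mixed bound.\<close>

lemma norm_Pair_combination_le:
  fixes a b :: real
  assumes "norm p \<le> a * r + b * s" and "norm q \<le> b * r + a * s"
    and "0 \<le> a" "0 \<le> b" "0 \<le> r" "0 \<le> s"
  shows "norm (p, q) \<le> (a + b) * norm (r, s)"
proof -
  have "norm (p, q) \<le> norm (a * r + b * s, b * r + a * s)"
    unfolding norm_Pair using assms by (intro real_sqrt_le_mono add_mono power_mono) auto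
  also have "\<dots> \<le> norm (a *\<^sub>R (r, s)) + norm (b *\<^sub>R (s, r))"
    by (rule order_trans[OF _ norm_triangle_ineq]) (simp add: add.commute)
  also have "\<dots> = (a + b) * norm (r, s)"
    using assms by (simp only: norm_scaleR) (simp add: norm_Pair algebra_simps)
  finally show ?thesis .
qed

text \<open>Serves to turn a bound on second differences of \<open>I\<close> into a bound on a
  gradient difference.\<close>

lemma DERIV_bound_of_increment:
  fixes \<psi> :: "real \<Rightarrow> real"
  assumes "(\<psi> has_real_derivative D) (at 0)" and "\<And>t. \<bar>\<psi> t - \<psi> 0\<bar> \<le> C * \<bar>t\<bar>"
  shows "\<bar>D\<bar> \<le> C"
proof -
  have "((\<lambda>t. (\<psi> t - \<psi> 0) / t) \<longlongrightarrow> D) (at 0)"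
    using assms(1) by (simp add: has_field_derivative_iff)
  then have "((\<lambda>t. \<bar>(\<psi> t - \<psi> 0) / t\<bar>) \<longlongrightarrow> \<bar>D\<bar>) (at 0)"
    by (rule tendsto_rabs)
  moreover have "\<forall>\<^sub>F t in at 0. \<bar>(\<psi> t - \<psi> 0) / t\<bar> \<le> C"
    unfolding eventually_at_topological
    using assms(2) by (auto simp: field_simps intro!: exI[of _ UNIV])
  ultimately show ?thesis
    by (intro tendsto_upperbound) auto
qed

section \<open>The coupling operator: block derivatives, monotonicity, Lipschitz continuity\<close>

context
  fixes I :: "'a::euclidean_space \<times> 'b::euclidean_space \<Rightarrow> real"
  assumes C2: "C2 I"
begin

lemma C2_gderiv: "GDERIV I z :> grad I z"
  using C2[unfolded C2_def] by (intro gderiv_grad) (elim conjE allE)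

lemma gderiv_grad_x: "GDERIV (\<lambda>x'. I (x', y)) x :> grad_x I x y"
  and grad_x_eq: "grad_x I x y = fst (grad I (x, y))"
proof -
  have 1: "((\<lambda>x'. (x', y)) has_derivative (\<lambda>u. (u, 0))) (at x)"
    by (auto intro!: derivative_eq_intros)
  have "(I has_derivative (\<lambda>u. inner u (grad I (x, y)))) (at (x, y))"
    using C2_gderiv by (simp add: gderiv_def)
  from has_derivative_compose[OF 1 this]
  have *: "GDERIV (\<lambda>x'. I (x', y)) x :> fst (grad I (x, y))"
    by (simp add: gderiv_def inner_prod_def)
  show "grad_x I x y = fst (grad I (x, y))"
    unfolding grad_x_def by (rule grad_eqI[OF *])
  with * show "GDERIV (\<lambda>x'. I (x', y)) x :> grad_x I x y" by simp
qed

lemma gderiv_grad_y: "GDERIV (\<lambda>y'. I (x, y')) y :> grad_y I x y"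
  and grad_y_eq: "grad_y I x y = snd (grad I (x, y))"
proof -
  have 1: "((\<lambda>y'. (x, y')) has_derivative (\<lambda>u. (0, u))) (at y)"
    by (auto intro!: derivative_eq_intros)
  have "(I has_derivative (\<lambda>u. inner u (grad I (x, y)))) (at (x, y))"
    using C2_gderiv by (simp add: gderiv_def)
  from has_derivative_compose[OF 1 this]
  have *: "GDERIV (\<lambda>y'. I (x, y')) y :> snd (grad I (x, y))"
    by (simp add: gderiv_def inner_prod_def)
  show "grad_y I x y = snd (grad I (x, y))"
    unfolding grad_y_def by (rule grad_eqI[OF *])
  with * show "GDERIV (\<lambda>y'. I (x, y')) y :> grad_y I x y" by simp
qed

lemma grad_differentiable: "grad I differentiable (at z)"
proof -
  obtain D2 :: "'a \<times> 'b \<Rightarrow> ('a \<times> 'b) \<Rightarrow>\<^sub>L ('a \<times> 'b)"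
    where "\<forall>z. (grad I has_derivative blinfun_apply (D2 z)) (at z)"
    using C2[unfolded C2_def] by (elim conjE exE)
  then show ?thesis
    unfolding differentiable_def by (intro exI) (rule spec)
qed

text \<open>By the chain rule, \<open>grad I\<close> composed with the embedding of one factor and a
  projection is differentiable, so \<open>frechet_derivative\<close> in the block definitions yields
  a genuine derivative.\<close>

lemma hess_has_derivative:
  "((\<lambda>x'. grad_x I x' y) has_derivative hess_xx I x y) (at x)"
  "((\<lambda>y'. grad_x I x y') has_derivative hess_xy I x y) (at y)"
  "((\<lambda>y'. grad_y I x y') has_derivative hess_yy I x y) (at y)"
proof -
  obtain D where D: "(grad I has_derivative D) (at (x, y))"
    using grad_differentiable unfolding differentiable_def by blast
  have X: "((\<lambda>x'. (x', y)) has_derivative (\<lambda>u. (u, 0))) (at x)"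
    and Y: "((\<lambda>y'. (x, y')) has_derivative (\<lambda>u. (0, u))) (at y)"
    by (auto intro!: derivative_eq_intros)
  have "(\<lambda>x'. grad_x I x' y) differentiable (at x)"
    "(\<lambda>y'. grad_x I x y') differentiable (at y)"
    "(\<lambda>y'. grad_y I x y') differentiable (at y)"
    unfolding differentiable_def grad_x_eq grad_y_eq
    using has_derivative_fst[OF has_derivative_compose[OF X D]]
      has_derivative_fst[OF has_derivative_compose[OF Y D]]
      has_derivative_snd[OF has_derivative_compose[OF Y D]] by blast+
  then show "((\<lambda>x'. grad_x I x' y) has_derivative hess_xx I x y) (at x)"
    "((\<lambda>y'. grad_x I x y') has_derivative hess_xy I x y) (at y)"
    "((\<lambda>y'. grad_y I x y') has_derivative hess_yy I x y) (at y)"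
    unfolding hess_xx_def hess_xy_def hess_yy_def frechet_derivative_works by simp_all
qed

text \<open>Add the tangent inequalities based at \<open>u\<close> and at \<open>v\<close>, in each
  of the two variables. The values of \<open>I\<close> at the four corners of the rectangle spanned
  by \<open>u\<close> and \<open>v\<close> cancel, and only the inner product is left.\<close>

lemma H_op_monotone:
  assumes cvx: "\<And>y. convex_on UNIV (\<lambda>x. I (x, y))"
    and ccv: "\<And>x. concave_on UNIV (\<lambda>y. I (x, y))"
  shows "inner (H_op I u - H_op I v) (u - v) \<ge> 0"
proof -
  obtain x y where u: "u = (x, y)" by fastforce
  obtain x' y' where v: "v = (x', y')" by fastforce
  have "GDERIV (\<lambda>y. - I (x, y)) y :> - grad_y I x y" for x y
    by (rule GDERIV_minus[OF gderiv_grad_y])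
  from convex_lower[OF ccv[unfolded concave_on_def] this]
  have Y: "- I (a, b') \<ge> - I (a, b) + inner (- grad_y I a b) (b' - b)" for a b b' by simp
  have X: "I (a', b) \<ge> I (a, b) + inner (grad_x I a b) (a' - a)" for a a' b
    by (rule convex_lower[OF cvx gderiv_grad_x])
  show ?thesis
    using X[of x' y x] X[of x y' x'] Y[of x y' y] Y[of x' y y']
    X[of x y x'] X[of x' y' x] Y[of x y y'] Y[of x' y' y]
    by (simp add: u v H_op_def inner_prod_def inner_diff_left inner_diff_right)
qed

text \<open>Mean value bounds hold block by block. Each gradient increment is split at the
  intermediate point \<open>(x', y)\<close>, and \<open>norm_Pair_combination_le\<close> joins the
  two components.\<close>

lemma H_op_lipschitz:
  assumes xx: "\<And>x y. onorm (hess_xx I x y) \<le> Ixx"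
    and xy: "\<And>x y. onorm (hess_xy I x y) \<le> Ixy"
    and yy: "\<And>x y. onorm (hess_yy I x y) \<le> Iyy"
  shows "(max Ixx Iyy + Ixy)-lipschitz_on UNIV (H_op I)"
proof (rule lipschitz_onI)
  \<comment> \<open>The parameters are nonnegative because each dominates the operator norm of a
    bounded linear map, here at the origin.\<close>
  have "0 \<le> Ixx"
    by (rule order_trans[OF onorm_pos_le xx[of 0 0]])
      (rule has_derivative_bounded_linear[OF hess_has_derivative(1)])
  moreover have "0 \<le> Ixy"
    by (rule order_trans[OF onorm_pos_le xy[of 0 0]])
      (rule has_derivative_bounded_linear[OF hess_has_derivative(2)])
  moreover have "0 \<le> Iyy"
    by (rule order_trans[OF onorm_pos_le yy[of 0 0]])
      (rule has_derivative_bounded_linear[OF hess_has_derivative(3)])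
  ultimately have nonneg: "0 \<le> Ixx" "0 \<le> Ixy" "0 \<le> Iyy" .
  then show "0 \<le> max Ixx Iyy + Ixy" by simp
  have Lxx: "norm (grad_x I a y - grad_x I b y) \<le> Ixx * norm (a - b)" for a b y
    by (rule differentiable_bound[OF convex_UNIV hess_has_derivative(1) xx]) auto
  have Lxy: "norm (grad_x I x a - grad_x I x b) \<le> Ixy * norm (a - b)" for a b x
    by (rule differentiable_bound[OF convex_UNIV hess_has_derivative(2) xy]) auto
  have Lyy: "norm (grad_y I x a - grad_y I x b) \<le> Iyy * norm (a - b)" for a b x
    by (rule differentiable_bound[OF convex_UNIV hess_has_derivative(3) yy]) auto
  \<comment> \<open>Bounding second differences of \<open>I\<close> transfers the mixed bound from the gradient in \<open>x\<close> to the
    gradient in \<open>y\<close> without appeal to the symmetry of the Hessian.\<close>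
  have Lyx: "norm (grad_y I a y - grad_y I b y) \<le> Ixy * norm (a - b)" for a b y
  proof -
    \<comment> \<open>Testing in the direction of the gradient difference itself makes the
      derivative of \<open>\<psi>\<close> at 0 equal to the squared norm of \<open>v\<close>; one
      factor \<open>norm v\<close> then cancels.\<close>
    define v where "v = grad_y I a y - grad_y I b y"
    define \<psi> where "\<psi> t = I (a, y + t *\<^sub>R v) - I (b, y + t *\<^sub>R v)" for t
    have "\<bar>\<psi> t - \<psi> 0\<bar> \<le> (Ixy * norm v * norm (a - b)) * \<bar>t\<bar>" for t
    proof -
      define w where "w = t *\<^sub>R v"
      \<comment> \<open>Read as a function of \<open>x\<close>, the increment
        \<open>I (x, y + w) - I (x, y)\<close> has as gradient a difference of \<open>grad_x\<close>
        at two values of \<open>y\<close>, which \<open>Lxy\<close> bounds.\<close>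
      have "norm ((I (a, y + w) - I (a, y)) - (I (b, y + w) - I (b, y)))
          \<le> (Ixy * norm w) * norm (a - b)"
      proof (rule differentiable_bound[OF convex_UNIV])
        fix x
        show "((\<lambda>x. I (x, y + w) - I (x, y)) has_derivative
            (\<lambda>u. inner u (grad_x I x (y + w) - grad_x I x y))) (at x within UNIV)"
          using GDERIV_diff[OF gderiv_grad_x[of "y + w" x] gderiv_grad_x[of y x]]
          by (simp add: gderiv_def)
        show "onorm (\<lambda>u. inner u (grad_x I x (y + w) - grad_x I x y)) \<le> Ixy * norm w"
        proof (rule onorm_bound)
          show "0 \<le> Ixy * norm w" using nonneg by simp
          show "norm (inner u (grad_x I x (y + w) - grad_x I x y)) \<le> Ixy * norm w * norm u" for u
          proof -
            have "norm (inner u (grad_x I x (y + w) - grad_x I x y))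
                \<le> norm u * norm (grad_x I x (y + w) - grad_x I x y)"
              by (simp add: Cauchy_Schwarz_ineq2)
            also have "\<dots> \<le> norm u * (Ixy * norm w)"
              using Lxy[of x "y + w" y] by (intro mult_left_mono) auto
            finally show ?thesis by (simp add: mult.commute)
          qed
        qed
      qed auto
      then show ?thesis by (simp add: \<psi>_def w_def algebra_simps)
    qed
    moreover have "(\<psi> has_real_derivative inner v v) (at 0)"
    proof -
      have "(\<psi> has_real_derivative inner (grad_y I a y) v - inner (grad_y I b y) v) (at 0)"
        unfolding \<psi>_def
        by (intro DERIV_diff gderiv_line[where h = "\<lambda>y. I (a, y)" for a]) (simp_all add: gderiv_grad_y)
      then show ?thesis by (simp add: v_def inner_diff_left)
    qed
    ultimately have "\<bar>inner v v\<bar> \<le> Ixy * norm v * norm (a - b)"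
      by (rule DERIV_bound_of_increment[rotated])
    then have "norm v * norm v \<le> norm v * (Ixy * norm (a - b))"
      by (simp add: dot_square_norm power2_eq_square algebra_simps)
    then show ?thesis
      using nonneg by (cases "v = 0") (auto simp: v_def)
  qed
  fix u v :: "'a \<times> 'b"
  obtain x y where u: "u = (x, y)" by fastforce
  obtain x' y' where v: "v = (x', y')" by fastforce
  let ?m = "max Ixx Iyy"
  have "norm (grad_x I x y - grad_x I x' y') \<le> Ixx * norm (x - x') + Ixy * norm (y - y')"
    using norm_triangle_le[OF add_mono[OF Lxx[of x y x'] Lxy[of x' y y']]] by simp
  also have "\<dots> \<le> ?m * norm (x - x') + Ixy * norm (y - y')"
    by (intro add_mono mult_right_mono) auto
  finally have 1: "norm (grad_x I x y - grad_x I x' y') \<le> \<dots>" .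
  have "norm (grad_y I x y - grad_y I x' y') \<le> Ixy * norm (x - x') + Iyy * norm (y - y')"
    using norm_triangle_le[OF add_mono[OF Lyx[of x y x'] Lyy[of x' y y']]] by simp
  also have "\<dots> \<le> Ixy * norm (x - x') + ?m * norm (y - y')"
    by (intro add_mono mult_right_mono) auto
  finally have 2: "norm (- grad_y I x y + grad_y I x' y') \<le> \<dots>"
    by (metis add.commute norm_minus_commute uminus_add_conv_diff)
  show "dist (H_op I u) (H_op I v) \<le> (?m + Ixy) * dist u v"
    using norm_Pair_combination_le[OF 1 2] nonneg
    by (simp add: u v H_op_def dist_norm norm_Pair)
qed

end

section \<open>The separable function F: gradient and quadratic bounds\<close>

lemma gderiv_F_op:
  assumes "GDERIV f (fst z) :> a" and "GDERIV g (snd z) :> b"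
  shows "GDERIV (F_op f g) z :> (a, b)"
proof -
  have "((\<lambda>z. f (fst z)) has_derivative (\<lambda>u. inner (fst u) a)) (at z)"
    using has_derivative_compose[OF has_derivative_fst[OF has_derivative_ident]
      assms(1)[unfolded gderiv_def]] .
  moreover have "((\<lambda>z. g (snd z)) has_derivative (\<lambda>u. inner (snd u) b)) (at z)"
    using has_derivative_compose[OF has_derivative_snd[OF has_derivative_ident]
      assms(2)[unfolded gderiv_def]] .
  ultimately show ?thesis
    unfolding gderiv_def F_op_def
    by (auto intro!: derivative_eq_intros simp: inner_prod_def)
qed

lemma grad_F_op:
  fixes f :: "'a::euclidean_space \<Rightarrow> real" and g :: "'b::euclidean_space \<Rightarrow> real"
  assumes "L_smooth Lf f" and "L_smooth Lg g"
  shows "grad (F_op f g) z = (grad f (fst z), grad g (snd z))"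
  using assms by (intro grad_eqI gderiv_F_op gderiv_grad) (auto simp: L_smooth_def)

lemma F_op_lower:
  fixes f :: "'a::euclidean_space \<Rightarrow> real" and g :: "'b::euclidean_space \<Rightarrow> real"
  assumes "strongly_convex \<mu>f f" "L_smooth Lf f" "strongly_convex \<mu>g g" "L_smooth Lg g"
  shows "F_op f g u \<ge> F_op f g v + inner (grad (F_op f g) v) (u - v)
    + min \<mu>f \<mu>g / 2 * (norm (u - v))\<^sup>2"
proof -
  let ?p = "(norm (fst u - fst v))\<^sup>2" and ?q = "(norm (snd u - snd v))\<^sup>2"
  have "f (fst u) \<ge> f (fst v) + inner (grad f (fst v)) (fst u - fst v) + \<mu>f / 2 * ?p"
    "g (snd u) \<ge> g (snd v) + inner (grad g (snd v)) (snd u - snd v) + \<mu>g / 2 * ?q"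
    using assms by (intro strongly_convex_lower gderiv_grad; simp add: L_smooth_def)+
  moreover have "min \<mu>f \<mu>g / 2 * ?p \<le> \<mu>f / 2 * ?p" "min \<mu>f \<mu>g / 2 * ?q \<le> \<mu>g / 2 * ?q"
    by (intro mult_right_mono; simp)+
  moreover have "(norm (u - v))\<^sup>2 = ?p + ?q"
    by (simp add: norm_prod_def)
  ultimately show ?thesis
    by (simp add: grad_F_op[OF assms(2,4)] F_op_def inner_prod_def distrib_left)
qed

lemma F_op_upper:
  fixes f :: "'a::euclidean_space \<Rightarrow> real" and g :: "'b::euclidean_space \<Rightarrow> real"
  assumes "L_smooth Lf f" "L_smooth Lg g"
  shows "F_op f g u \<le> F_op f g v + inner (grad (F_op f g) v) (u - v)
    + max Lf Lg / 2 * (norm (u - v))\<^sup>2"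
proof -
  let ?p = "(norm (fst u - fst v))\<^sup>2" and ?q = "(norm (snd u - snd v))\<^sup>2"
  have "f (fst u) \<le> f (fst v) + inner (grad f (fst v)) (fst u - fst v) + Lf / 2 * ?p"
    "g (snd u) \<le> g (snd v) + inner (grad g (snd v)) (snd u - snd v) + Lg / 2 * ?q"
    using assms by (intro lipschitz_gradient_upper gderiv_grad; simp add: L_smooth_def)+
  moreover have "Lf / 2 * ?p \<le> max Lf Lg / 2 * ?p" "Lg / 2 * ?q \<le> max Lf Lg / 2 * ?q"
    by (intro mult_right_mono; simp)+
  moreover have "(norm (u - v))\<^sup>2 = ?p + ?q"
    by (simp add: norm_prod_def)
  ultimately show ?thesis
    by (simp add: grad_F_op[OF assms] F_op_def inner_prod_def distrib_left)
qed

section \<open>The accelerated optimistic iteration in an abstract inner product space\<close>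

locale agog =
  fixes F :: "'z::real_inner \<Rightarrow> real" and G H :: "'z \<Rightarrow> 'z"
    and L \<mu> LH c :: real and \<alpha> \<eta> :: "nat \<Rightarrow> real" and zs :: 'z
  assumes lower: "\<And>u v. F u \<ge> F v + inner (G v) (u - v) + \<mu> / 2 * (norm (u - v))\<^sup>2"
    and upper: "\<And>u v. F u \<le> F v + inner (G v) (u - v) + L / 2 * (norm (u - v))\<^sup>2"
    and monotone: "\<And>u v. inner (H u - H v) (u - v) \<ge> 0"
    and lipschitz: "LH-lipschitz_on UNIV H"
    and stationary: "G zs + H zs = 0"
    and mu_pos: "\<mu> > 0" and L_pos: "L > 0" and c_ge: "c \<ge> 2"
    and alpha: "\<And>k. \<alpha> k = 2 / (real k + 2)"
    and eta: "\<And>k. \<eta> k = (real k + 2) / (2 * L + c * LH * (real k + 2))"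
begin

text \<open>At the saddle point \<open>G zs = - H zs\<close>, so the linear term is a pairing with
  \<open>H zs\<close>. The coupling thus enters through monotonicity of \<open>H\<close>, with no
  duality gap.\<close>

definition V where "V z = F z - F zs - inner (G zs) (z - zs)"

lemma V_lower: "V z \<ge> \<mu> / 2 * (norm (z - zs))\<^sup>2"
  using lower[where u=z and v=zs] by (simp add: V_def)

lemma V_nonneg: "V z \<ge> 0"
  using V_lower[of z] mu_pos by (smt (verit) divide_nonneg_nonneg mult_nonneg_nonneg zero_le_power2)

lemma LH_nonneg: "LH \<ge> 0"
  using lipschitz by (rule lipschitz_on_nonneg)

lemma denom_pos: "2 * L + c * LH * (real k + 2) > 0"
  using L_pos LH_nonneg c_ge by (intro add_pos_nonneg) auto

text \<open>Smoothness is applied at \<open>md\<close>, where the new point differs from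
  \<open>md\<close> by only \<open>a (zh - z)\<close>; hence the factor \<open>a\<^sup>2\<close>.
  Convexity at \<open>md\<close>, towards \<open>ag\<close> and \<open>zs\<close> with weights
  \<open>1 - a\<close> and \<open>a\<close>, removes the remaining values at
  \<open>md\<close>.\<close>

lemma V_extrapolation:
  assumes a: "0 \<le> a" "a \<le> 1" and md: "md = (1 - a) *\<^sub>R ag + a *\<^sub>R z"
  shows "V ((1 - a) *\<^sub>R ag + a *\<^sub>R zh)
    \<le> (1 - a) * V ag + a * inner (G md + H zh) (zh - zs) + L / 2 * a\<^sup>2 * (norm (zh - z))\<^sup>2"
proof -
  let ?ag = "(1 - a) *\<^sub>R ag + a *\<^sub>R zh"
  have "?ag - md = a *\<^sub>R (zh - z)" by (simp add: md algebra_simps)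
  with upper[where u="?ag" and v=md]
  have up: "F ?ag \<le> F md + inner (G md) (?ag - md) + L / 2 * a\<^sup>2 * (norm (zh - z))\<^sup>2"
    by (simp add: power_mult_distrib)
  have cvx: "F u \<ge> F md + inner (G md) (u - md)" for u
    using lower[where u=u and v=md] mu_pos
    by (smt (verit) divide_nonneg_nonneg mult_nonneg_nonneg zero_le_power2)
  have "(1 - a) * (F md + inner (G md) (ag - md)) + a * (F md + inner (G md) (zs - md))
      \<le> (1 - a) * F ag + a * F zs"
    using a cvx by (intro add_mono mult_left_mono) auto
  \<comment> \<open>The weights are those of the extrapolation, so \<open>ag\<close> and
    \<open>md\<close> drop out and only \<open>zh - zs\<close> remains.\<close>
  moreover have "inner (G md) (?ag - md) - (1 - a) * inner (G md) (ag - md)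
      - a * inner (G md) (zs - md) = a * inner (G md) (zh - zs)"
    by (simp add: inner_diff_right inner_add_right algebra_simps)
  ultimately have "F ?ag \<le> (1 - a) * F ag + a * F zs + a * inner (G md) (zh - zs)
      + L / 2 * a\<^sup>2 * (norm (zh - z))\<^sup>2"
    using up by (simp add: algebra_simps)
  moreover have "inner (G zs) (?ag - zs)
      = (1 - a) * inner (G zs) (ag - zs) + a * inner (G zs) (zh - zs)"
    by (simp add: inner_diff_right inner_add_right algebra_simps)
  \<comment> \<open>The linear term of \<open>V\<close> along \<open>zh - zs\<close> becomes a
    pairing with \<open>H zs\<close>, which monotonicity replaces by \<open>H zh\<close>, the value
    the algorithm evaluates.\<close>
  moreover have "G zs = - H zs"
    using stationary by (simp add: eq_neg_iff_add_eq_0)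
  moreover have "a * inner (H zs) (zh - zs) \<le> a * inner (H zh) (zh - zs)"
    using monotone[of zh zs] a by (intro mult_left_mono) (auto simp: inner_diff_left)
  ultimately show ?thesis
    by (simp add: V_def inner_add_left algebra_simps)
qed

text \<open>The full step gives \<open>e (p + H zh) = z - z'\<close>; the rest is the four-point
  polarization identity.\<close>

lemma optimistic_step:
  assumes zh: "zh = z - e *\<^sub>R (H zp + p)" and z': "z' = z - e *\<^sub>R (H zh + p)"
  shows "2 * e * inner (p + H zh) (zh - zs)
      = (norm (z - zs))\<^sup>2 - (norm (z' - zs))\<^sup>2 + (norm (z' - zh))\<^sup>2 - (norm (zh - z))\<^sup>2"
proof -
  have "e *\<^sub>R (p + H zh) = z - z'" by (simp add: z' algebra_simps)
  then have "2 * e * inner (p + H zh) (zh - zs) = 2 * inner (z - z') (zh - zs)"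
    by (metis inner_scaleR_left mult.assoc)
  also have "\<dots> = (norm (z - zs))\<^sup>2 - (norm (z' - zs))\<^sup>2 + (norm (z' - zh))\<^sup>2 - (norm (zh - z))\<^sup>2"
    by (simp add: power2_norm_eq_inner inner_diff_left inner_diff_right inner_commute)
  finally show ?thesis .
qed

text \<open>Both updates start at \<open>z\<close> and share \<open>p\<close>, so they differ only
  by \<open>e (H zp - H zh)\<close>. With \<open>t = e * LH\<close>, splitting at \<open>z\<close>
  gives the factor \<open>(2 * t)\<^sup>2\<close>, and \<open>2 * t \<le> c * t \<le> 1\<close>
  bounds it by \<open>c * t\<close> and by 1. Of the two copies on the left, one cancels the error
  in \<open>optimistic_step\<close> and the other enters the next potential.\<close>

lemma optimistic_error:
  assumes zh: "zh = z - e *\<^sub>R (H zp + p)" and z': "z' = z - e *\<^sub>R (H zh + p)"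
    and e: "0 \<le> e" "c * (e * LH) \<le> 1"
  shows "2 * (norm (z' - zh))\<^sup>2 \<le> c * (e * LH) * (norm (zh - z))\<^sup>2 + (norm (z - zp))\<^sup>2"
proof -
  define t where "t = e * LH"
  have t: "0 \<le> t" "c * t \<le> 1" using e LH_nonneg by (auto simp: t_def)
  have "2 * t \<le> c * t" using t c_ge by (intro mult_right_mono) auto
  then have "2 * t \<le> 1" using t by linarith
  have "z' - zh = e *\<^sub>R (H zp - H zh)" by (simp add: z' zh algebra_simps)
  then have "norm (z' - zh) = e * norm (H zp - H zh)" using e by simp
  also have "\<dots> \<le> e * (LH * norm (zp - zh))"
    using lipschitz_onD[OF lipschitz, of zp zh] e by (intro mult_left_mono) (auto simp: dist_norm)
  also have "\<dots> \<le> t * (norm (zh - z) + norm (z - zp))"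
    using norm_triangle_ineq[of "zh - z" "z - zp"] t
    by (auto simp: t_def norm_minus_commute mult.assoc[symmetric] intro!: mult_left_mono)
  finally have "(norm (z' - zh))\<^sup>2 \<le> (t * (norm (zh - z) + norm (z - zp)))\<^sup>2"
    by (intro power_mono) auto
  also have "\<dots> \<le> t\<^sup>2 * (2 * (norm (zh - z))\<^sup>2 + 2 * (norm (z - zp))\<^sup>2)"
    unfolding power_mult_distrib
    by (intro mult_left_mono) (use sum_squares_bound[of "norm (zh - z)" "norm (z - zp)"] in
      \<open>auto simp: power2_sum\<close>)
  finally have "2 * (norm (z' - zh))\<^sup>2 \<le> (2 * t)\<^sup>2 * (norm (zh - z))\<^sup>2 + (2 * t)\<^sup>2 * (norm (z - zp))\<^sup>2"
    by (simp add: power_mult_distrib algebra_simps)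
  also have "\<dots> \<le> c * t * (norm (zh - z))\<^sup>2 + 1 * (norm (z - zp))\<^sup>2"
  proof (intro add_mono mult_right_mono)
    have "(2 * t)\<^sup>2 \<le> 2 * t" using t \<open>2 * t \<le> 1\<close> by (simp only: power2_eq_square mult_left_le)
    with \<open>2 * t \<le> c * t\<close> \<open>2 * t \<le> 1\<close> show "(2 * t)\<^sup>2 \<le> c * t" "(2 * t)\<^sup>2 \<le> 1" by linarith+
  qed auto
  finally show ?thesis by (simp add: t_def)
qed

lemma agog_step:
  assumes zh: "zh = z - \<eta> k *\<^sub>R (H zp + G md)" and z': "z' = z - \<eta> k *\<^sub>R (H zh + G md)"
    and md: "md = (1 - \<alpha> k) *\<^sub>R ag + \<alpha> k *\<^sub>R z"
  defines "D \<equiv> 2 * L + c * LH * (real k + 2)"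
  shows "(real k + 2)\<^sup>2 / D * V ((1 - \<alpha> k) *\<^sub>R ag + \<alpha> k *\<^sub>R zh)
      + (norm (z' - zs))\<^sup>2 + (norm (z' - zh))\<^sup>2
    \<le> real k * (real k + 2) / D * V ag + (norm (z - zs))\<^sup>2 + (norm (z - zp))\<^sup>2"
proof -
  have D: "D > 0" unfolding D_def by (rule denom_pos)
  have \<eta>: "\<eta> k = (real k + 2) / D" by (simp add: eta D_def)
  \<comment> \<open>The weight is \<open>2 * \<eta> k / \<alpha> k\<close>, so that the inner
    product acquires the coefficient \<open>2 * \<eta> k\<close> of
    \<open>optimistic_step\<close>.\<close>
  let ?w = "(real k + 2)\<^sup>2 / D" and ?X = "inner (G md + H zh) (zh - zs)" and ?n = "(norm (zh - z))\<^sup>2"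
  have "V ((1 - \<alpha> k) *\<^sub>R ag + \<alpha> k *\<^sub>R zh)
    \<le> (1 - \<alpha> k) * V ag + \<alpha> k * ?X + L / 2 * (\<alpha> k)\<^sup>2 * ?n"
    by (rule V_extrapolation[OF _ _ md]) (auto simp: alpha)
  then have "?w * V ((1 - \<alpha> k) *\<^sub>R ag + \<alpha> k *\<^sub>R zh)
    \<le> ?w * ((1 - \<alpha> k) * V ag + \<alpha> k * ?X + L / 2 * (\<alpha> k)\<^sup>2 * ?n)"
    using D by (intro mult_left_mono) auto
  also have "\<dots> = ?w * (1 - \<alpha> k) * V ag + ?w * \<alpha> k * ?X + ?w * (L / 2 * (\<alpha> k)\<^sup>2) * ?n"
    by (simp add: distrib_left mult.assoc)
  also have "?w * (1 - \<alpha> k) = real k * (real k + 2) / D"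
  proof -
    have "1 - \<alpha> k = real k / (real k + 2)"
      by (simp add: alpha field_simps)
    then show ?thesis
      by (simp add: power2_eq_square)
  qed
  also have "?w * \<alpha> k = 2 * \<eta> k"
    by (simp add: alpha \<eta> power2_eq_square)
  \<comment> \<open>The curvature term leaves the fraction \<open>c \<eta>\<^sub>k LH\<close> of the squared half step to pay for the
    extrapolation error.\<close>
  also have "?w * (L / 2 * (\<alpha> k)\<^sup>2) = 1 - c * (\<eta> k * LH)"
  proof -
    have "?w * (L / 2 * (\<alpha> k)\<^sup>2) = 2 * L / D"
      by (simp add: alpha power_divide)
    also have "\<dots> = 1 - c * (\<eta> k * LH)"
      using D by (simp add: \<eta> field_simps) (simp add: D_def algebra_simps)
    finally show ?thesis .
  qed
  finally have "?w * V ((1 - \<alpha> k) *\<^sub>R ag + \<alpha> k *\<^sub>R zh)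
    \<le> real k * (real k + 2) / D * V ag + 2 * \<eta> k * ?X + (1 - c * (\<eta> k * LH)) * ?n" .
  moreover have "2 * (norm (z' - zh))\<^sup>2 \<le> c * (\<eta> k * LH) * ?n + (norm (z - zp))\<^sup>2"
  proof (rule optimistic_error[OF zh z'])
    show "0 \<le> \<eta> k" using D by (simp add: \<eta>)
    show "c * (\<eta> k * LH) \<le> 1"
      using D L_pos by (simp add: \<eta> field_simps) (simp add: D_def algebra_simps)
  qed
  moreover note optimistic_step[OF zh z']
  ultimately show ?thesis by (simp add: algebra_simps)
qed

text \<open>Compares the coefficient of \<open>V\<close> entering iteration \<open>k + 1\<close>
  with the one left by iteration \<open>k\<close>: the numerator does not grow and the denominator
  does not shrink.\<close>

lemma weight_mono:
  "(real k + 1) * (real k + 3) / (2 * L + c * LH * (real k + 3))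
    \<le> (real k + 2)\<^sup>2 / (2 * L + c * LH * (real k + 2))"
proof (rule frac_le)
  show "(real k + 1) * (real k + 3) \<le> (real k + 2)\<^sup>2"
    by (simp add: power2_eq_square algebra_simps)
  show "2 * L + c * LH * (real k + 2) \<le> 2 * L + c * LH * (real k + 3)"
    using LH_nonneg c_ge by (intro add_mono mult_left_mono) auto
qed (auto intro: denom_pos)

text \<open>Telescopes \<open>agog_step\<close>, with \<open>weight_mono\<close> bridging
  consecutive coefficients. The state is taken after iteration \<open>k\<close>, hence
  \<open>Suc k\<close> beside the weight in \<open>k + 2\<close>.\<close>

lemma agog_invariant:
  assumes "agog_state \<alpha> \<eta> H G z0 z0 z0 (Suc k) = (ag, z, zp)"
  shows "(real k + 2)\<^sup>2 / (2 * L + c * LH * (real k + 2)) * V ag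
      + (norm (z - zs))\<^sup>2 + (norm (z - zp))\<^sup>2 \<le> (norm (z0 - zs))\<^sup>2"
  using assms
proof (induction k arbitrary: ag z zp)
  \<comment> \<open>At \<open>k = 0\<close> the coefficient of \<open>V\<close> is 0, and
    \<open>z0\<close> also serves as the previous half point, so only the initial distance
    remains.\<close>
  case 0
  then show ?case
    using agog_step[OF refl refl refl, of 0 z0 z0 z0]
    by (auto simp: Let_def)
next
  case (Suc k)
  obtain ag' y yp where st: "agog_state \<alpha> \<eta> H G z0 z0 z0 (Suc k) = (ag', y, yp)"
    by (metis prod_cases3)
  define md where "md = (1 - \<alpha> (Suc k)) *\<^sub>R ag' + \<alpha> (Suc k) *\<^sub>R y"
  define zh where "zh = y - \<eta> (Suc k) *\<^sub>R (H yp + G md)"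
  have "ag = (1 - \<alpha> (Suc k)) *\<^sub>R ag' + \<alpha> (Suc k) *\<^sub>R zh" "zp = zh"
    and z: "z = y - \<eta> (Suc k) *\<^sub>R (H zh + G md)"
    using Suc.prems unfolding agog_state.simps(2)[of _ _ _ _ _ _ _ "Suc k"] st
    by (auto simp: Let_def zh_def md_def)
  then have "(real (Suc k) + 2)\<^sup>2 / (2 * L + c * LH * (real (Suc k) + 2)) * V ag
      + (norm (z - zs))\<^sup>2 + (norm (z - zp))\<^sup>2
    \<le> real (Suc k) * (real (Suc k) + 2) / (2 * L + c * LH * (real (Suc k) + 2)) * V ag'
      + (norm (y - zs))\<^sup>2 + (norm (y - yp))\<^sup>2"
    using agog_step[OF zh_def z md_def] by simp
  also have "real (Suc k) * (real (Suc k) + 2) / (2 * L + c * LH * (real (Suc k) + 2)) * V ag'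
      \<le> (real k + 2)\<^sup>2 / (2 * L + c * LH * (real k + 2)) * V ag'"
    using weight_mono[of k] by (intro mult_right_mono V_nonneg) (simp add: add_ac)
  finally show ?case using Suc.IH[OF st] by simp
qed

text \<open>Keep only the \<open>V\<close> term of the invariant and apply \<open>V_lower\<close>.
  With \<open>K = Suc k\<close> the weight has \<open>k + 2 = K + 1\<close>, and the two summands of
  its denominator give the two rates.\<close>

theorem agog_rate:
  assumes "K \<ge> 1"
  shows "(norm (agog_output \<alpha> \<eta> H G z0 z0 z0 K - zs))\<^sup>2
    \<le> (4 * L / (\<mu> * (real K + 1)\<^sup>2) + 2 * c * LH / (\<mu> * (real K + 1))) * (norm (z0 - zs))\<^sup>2"
proof -
  obtain k where K: "K = Suc k" using assms by (cases K) auto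
  obtain ag z zp where st: "agog_state \<alpha> \<eta> H G z0 z0 z0 (Suc k) = (ag, z, zp)"
    by (metis prod_cases3)
  define D where "D = 2 * L + c * LH * (real k + 2)"
  have D: "D > 0" unfolding D_def by (rule denom_pos)
  have "(real k + 2)\<^sup>2 / D * (\<mu> / 2 * (norm (ag - zs))\<^sup>2) \<le> (real k + 2)\<^sup>2 / D * V ag"
    using D by (intro mult_left_mono V_lower) auto
  also have "\<dots> \<le> (norm (z0 - zs))\<^sup>2"
    using agog_invariant[OF st] by (smt (verit) D_def zero_le_power2)
  finally have "(norm (ag - zs))\<^sup>2 \<le> 2 * D / (\<mu> * (real k + 2)\<^sup>2) * (norm (z0 - zs))\<^sup>2"
    using D mu_pos by (simp add: field_simps)
  also have "2 * D / (\<mu> * (real k + 2)\<^sup>2)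
      = 4 * L / (\<mu> * (real K + 1)\<^sup>2) + 2 * c * LH / (\<mu> * (real K + 1))"
  proof -
    have "2 * (2 * L + c * LH * a) / (\<mu> * a\<^sup>2) = 4 * L / (\<mu> * a\<^sup>2) + 2 * c * LH / (\<mu> * a)"
      if "a > 0" for a
      using that mu_pos by (simp add: power2_eq_square distrib_left add_divide_distrib)
    from this[of "real k + 2"] have "2 * (2 * L + c * LH * (real k + 2)) / (\<mu> * (real k + 2)\<^sup>2)
        = 4 * L / (\<mu> * (real k + 2)\<^sup>2) + 2 * c * LH / (\<mu> * (real k + 2))" by linarith
    moreover have "real K + 1 = real k + 2" by (simp add: K)
    ultimately show ?thesis by (simp only: D_def)
  qed
  finally show ?thesis by (simp only: agog_output_def K st fst_conv)
qed

end

section \<open>Instantiation to the saddle point problem\<close>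

theorem theorem3p3:
  fixes f :: "(real ^ 'n) \<Rightarrow> real" and g :: "(real ^ 'm) \<Rightarrow> real"
    and I :: "(real ^ 'n) \<times> (real ^ 'm) \<Rightarrow> real"
    and \<mu>f \<mu>g Lf Lg Ixx Ixy Iyy \<mu> L LH :: real
    and \<alpha> \<eta> :: "nat \<Rightarrow> real" and K :: nat
    and z0 zstar :: "(real ^ 'n) \<times> (real ^ 'm)"
  assumes "\<mu>f > 0" and "strongly_convex \<mu>f f" and "L_smooth Lf f"
    and "\<mu>g > 0" and "strongly_convex \<mu>g g" and "L_smooth Lg g"
    and "C2 I"
    and "\<And>y. convex_on UNIV (\<lambda>x. I (x, y))"
    and "\<And>x. concave_on UNIV (\<lambda>y. I (x, y))"
    and "\<And>x y. onorm (hess_xx I x y) \<le> Ixx"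
    and "\<And>x y. onorm (hess_xy I x y) \<le> Ixy"
    and "\<And>x y. onorm (hess_yy I x y) \<le> Iyy"
    and "grad (F_op f g) zstar + H_op I zstar = 0"
    and "L = max Lf Lg" and "\<mu> = min \<mu>f \<mu>g" and "LH = max Ixx Iyy + Ixy"
    and "K \<ge> 1"
    and "\<And>k. \<alpha> k = 2 / (real k + 2)"
    and "\<And>k. \<eta> k = (real k + 2) / (2 * L + sqrt (3 + sqrt 3) * LH * (real k + 2))"
  shows "(norm (agog_output \<alpha> \<eta> (H_op I) (grad (F_op f g)) z0 z0 z0 K - zstar))\<^sup>2
    \<le> (4 * L / (\<mu> * (real K + 1)\<^sup>2) + 2 * sqrt (3 + sqrt 3) * LH / (\<mu> * (real K + 1)))
       * (norm (z0 - zstar))\<^sup>2"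
proof -
  let ?F = "F_op f g"
  have lower: "?F u \<ge> ?F v + inner (grad ?F v) (u - v) + \<mu> / 2 * (norm (u - v))\<^sup>2" for u v
    using F_op_lower[OF assms(2,3,5,6)] by (simp add: assms(15))
  have upper: "?F u \<le> ?F v + inner (grad ?F v) (u - v) + L / 2 * (norm (u - v))\<^sup>2" for u v
    using F_op_upper[OF assms(3,6)] by (simp add: assms(14))
  have \<mu>: "\<mu> > 0" using assms(1,4,15) by simp
  \<comment> \<open>Comparing the lower and upper quadratic bounds between the origin and a unit
    vector gives \<open>\<mu> \<le> L\<close>, and thereby the positivity of
    \<open>L\<close>.\<close>
  obtain b :: "(real ^ 'n) \<times> (real ^ 'm)" where "b \<in> Basis"
    using nonempty_Basis by blast
  then have "\<mu> \<le> L" using lower[of 0 b] upper[of b 0] by simp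
  have "2\<^sup>2 \<le> 3 + sqrt 3" by simp
  then have c: "2 \<le> sqrt (3 + sqrt 3)" by (rule real_le_rsqrt)
  interpret agog ?F "grad ?F" "H_op I" L \<mu> LH "sqrt (3 + sqrt 3)" \<alpha> \<eta> zstar
    by unfold_locales
      (use lower upper \<mu> \<open>\<mu> \<le> L\<close> c assms(13,18,19) H_op_monotone[OF assms(7-9)]
        H_op_lipschitz[OF assms(7,10-12)] assms(16) in auto)
  show ?thesis by (rule agog_rate[OF assms(17)])
qed

end
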